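(* Let $f_1,\dots,f_m\in C^1(\mathbb{R}^n)$ have Lipschitz gradients with constants $L_i\ge0$ on $\mathbb{R}^n$, and let $\delta>0$. For every $\tau>0$ and every iterate $z_k=(x_k,t_k)\in\mathbb{R}^n\times\mathbb{R}$, $$P_k\succeq\delta I_{n+1}\succ 0.$$
   Context: $\succeq,\succ$ refer to the Loewner order on symmetric matrices. $\bar L=\sum_{i=1}^m L_i$. At $z_k=(x_k,t_k)$ put $r_{i,k}=f_i(x_k)-t_k$, $\omega_{i,k}=\sqrt{r_{i,k}^2+\tau^2}$; $J_k$ is the $m\times(n+1)$ matrix whose $i$-th row is $(\nabla f_i(x_k)^T,\,-1)$; $D_k=\operatorname{diag}(\omega_{1,k}^{-1},\dots,\omega_{m,k}^{-1})$; $\Pi_x=\operatorname{diag}(I_n,0)\in\mathbb{R}^{(n+1)\times(n+1)}$. The metric is $P_k=\delta I_{n+1}+\bar L\,\Pi_x+\frac12J_k^TD_kJ_k$. *)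

theory Defs
  imports "HOL-Analysis.Analysis"
begin

(* Junk value where f is not differentiable; see gradient_eqI for the differentiable case. *)
definition gradient :: "(real^'n \<Rightarrow> real) \<Rightarrow> real^'n \<Rightarrow> real^'n" where
  "gradient f x = (THE D. GDERIV f x :> D)"

definition C1 :: "(real^'n \<Rightarrow> real) \<Rightarrow> bool" where
  "C1 f \<longleftrightarrow> (\<forall>x. f differentiable (at x)) \<and> continuous_on UNIV (gradient f)"

definition symmetric_matrix :: "real^'a^'a \<Rightarrow> bool" where
  "symmetric_matrix A \<longleftrightarrow> transpose A = A"

definition loewner_ge :: "real^'a^'a \<Rightarrow> real^'a^'a \<Rightarrow> bool" (infix \<open>\<succeq>\<close> 50) where
  "A \<succeq> B \<longleftrightarrow> symmetric_matrix A \<and> symmetric_matrix B \<and> (\<forall>v. 0 \<le> v \<bullet> ((A - B) *v v))"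

definition loewner_gt :: "real^'a^'a \<Rightarrow> real^'a^'a \<Rightarrow> bool" (infix \<open>\<succ>\<close> 50) where
  "A \<succ> B \<longleftrightarrow> symmetric_matrix A \<and> symmetric_matrix B \<and> (\<forall>v. v \<noteq> 0 \<longrightarrow> 0 < v \<bullet> ((A - B) *v v))"

definition diag :: "('a \<Rightarrow> real) \<Rightarrow> real^'a^'a" where
  "diag d = (\<chi> i j. if i = j then d i else 0)"

(* The functions f_1, ..., f_m are indexed by a finite type 'm.  The n+1 coordinates of
   z = (x, t) are indexed by 'n option: Some j is the j-th coordinate of x and None is t. *)

definition residual :: "('m \<Rightarrow> real^'n \<Rightarrow> real) \<Rightarrow> (real^'n) \<times> real \<Rightarrow> 'm \<Rightarrow> real" where
  "residual f z i = f i (fst z) - snd z"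

definition omega :: "('m \<Rightarrow> real^'n \<Rightarrow> real) \<Rightarrow> real \<Rightarrow> (real^'n) \<times> real \<Rightarrow> 'm \<Rightarrow> real" where
  "omega f \<tau> z i = sqrt ((residual f z i)\<^sup>2 + \<tau>\<^sup>2)"

definition J_mat :: "('m \<Rightarrow> real^'n \<Rightarrow> real) \<Rightarrow> (real^'n) \<times> real \<Rightarrow> real^('n option)^'m" where
  "J_mat f z = (\<chi> i j. case j of Some l \<Rightarrow> gradient (f i) (fst z) $ l | None \<Rightarrow> -1)"

definition D_mat :: "('m \<Rightarrow> real^'n \<Rightarrow> real) \<Rightarrow> real \<Rightarrow> (real^'n) \<times> real \<Rightarrow> real^'m^'m" where
  "D_mat f \<tau> z = diag (\<lambda>i. inverse (omega f \<tau> z i))"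

definition Pi_x :: "real^('n::finite option)^('n option)" where
  "Pi_x = diag (\<lambda>j. case j of Some _ \<Rightarrow> 1 | None \<Rightarrow> 0)"

definition P_mat ::
  "('m::finite \<Rightarrow> real^'n \<Rightarrow> real) \<Rightarrow> ('m \<Rightarrow> real) \<Rightarrow> real \<Rightarrow> real \<Rightarrow> (real^'n) \<times> real
     \<Rightarrow> real^('n option)^('n option)" where
  "P_mat f L \<delta> \<tau> z =
     \<delta> *\<^sub>R mat 1 + (\<Sum>i\<in>UNIV. L i) *\<^sub>R Pi_x
       + (1/2) *\<^sub>R (transpose (J_mat f z) ** D_mat f \<tau> z ** J_mat f z)"

lemma gradient_eqI:
  assumes "GDERIV f x :> D"
  shows "gradient f x = D"
  unfolding gradient_def
proof (rule the_equality, fact assms)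
  fix E assume "GDERIV f x :> E"
  with assms have "(\<lambda>h. h \<bullet> E) = (\<lambda>h. h \<bullet> D)"
    unfolding gderiv_def using has_derivative_unique by blast
  then have "\<forall>h. h \<bullet> E = h \<bullet> D"
    by (rule fun_cong[THEN allI])
  then show "E = D"
    by (metis vector_eq_ldot)
qed

end

theory Submission
  imports Defs
begin

text \<open>
  The matrix $P - \delta I = \bar L\,\Pi_x + \frac12 J^T D J$ is a nonnegative combination of two
  positive semidefinite matrices. The first, \<^const>\<open>Pi_x\<close>, is diagonal with entries $0$ and $1$.
  The second is a congruence transform of the diagonal matrix $D$, whose entries
  $\omega_i^{-1}$ are nonnegative, so its quadratic form at $v$ is the form of $D$ at $J v$
  (\<open>inner_congruence\<close>). Both forms thus reduce to weighted sums of squares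
  (\<open>inner_diag_nonneg\<close>). Finally $\delta I \<succ> 0$, since its quadratic form is
  $\delta \<bar>v\<bar>^2$.
\<close>

lemma symmetric_matrix_diag: "symmetric_matrix (diag d)"
  by (simp add: symmetric_matrix_def diag_def transpose_def vec_eq_iff)

lemma symmetric_matrix_mat: "symmetric_matrix (mat c)"
  by (simp add: symmetric_matrix_def transpose_mat)

lemma symmetric_matrix_zero: "symmetric_matrix 0"
  by (simp add: symmetric_matrix_def transpose_def vec_eq_iff)

lemma symmetric_matrix_add:
  assumes "symmetric_matrix A" and "symmetric_matrix B"
  shows "symmetric_matrix (A + B)"
  using assms by (simp add: symmetric_matrix_def transpose_def vec_eq_iff)

lemma symmetric_matrix_scaleR:
  assumes "symmetric_matrix A"
  shows "symmetric_matrix (c *\<^sub>R A)"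
  using assms by (simp add: symmetric_matrix_def transpose_scalar)

lemma symmetric_matrix_congruence:
  fixes J :: "real^'n^'m"
  assumes "symmetric_matrix D"
  shows "symmetric_matrix (transpose J ** D ** J)"
  using assms by (simp add: symmetric_matrix_def matrix_transpose_mul matrix_mul_assoc)

lemma inner_diag_nonneg:
  assumes "\<And>i. 0 \<le> d i"
  shows "0 \<le> v \<bullet> (diag d *v v)"
proof -
  have "diag d *v v = (\<chi> i. d i * v $ i)"
    by (simp add: diag_def matrix_vector_mult_def vec_eq_iff if_distrib
        [of "\<lambda>c. c * _"] cong: if_cong)
  then have "v \<bullet> (diag d *v v) = (\<Sum>i\<in>UNIV. d i * (v $ i)\<^sup>2)"
    by (simp add: inner_vec_def power2_eq_square mult_ac)
  then show ?thesis
    using assms by (simp add: sum_nonneg)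
qed

lemma inner_congruence:
  fixes J :: "real^'n^'m"
  shows "v \<bullet> ((transpose J ** D ** J) *v v) = (J *v v) \<bullet> (D *v (J *v v))"
proof -
  have "v \<bullet> (transpose J *v w) = (J *v v) \<bullet> w" for w
    by (metis dot_lmul_matrix transpose_matrix_vector inner_commute)
  then show ?thesis
    by (simp flip: matrix_vector_mul_assoc)
qed

theorem proposition3p1:
  fixes f :: "'m::finite \<Rightarrow> real^'n \<Rightarrow> real"
    and L :: "'m \<Rightarrow> real"
    and \<delta> :: real
  assumes "\<And>i. C1 (f i)"
    and "\<And>i. L i \<ge> 0"
    and "\<And>i. (L i)-lipschitz_on UNIV (gradient (f i))"
    and "\<delta> > 0"
  shows "\<forall>\<tau>>0. \<forall>z :: (real^'n) \<times> real.
           P_mat f L \<delta> \<tau> z \<succeq> \<delta> *\<^sub>R mat 1 \<and>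
           (\<delta> *\<^sub>R mat 1 :: real^('n option)^('n option)) \<succ> 0"
proof (intro allI impI conjI)
  fix \<tau> :: real and z :: "(real^'n) \<times> real"
  let ?J = "J_mat f z" and ?D = "D_mat f \<tau> z" and ?c = "\<Sum>i\<in>UNIV. L i"
  have symD: "symmetric_matrix ?D"
    unfolding D_mat_def by (rule symmetric_matrix_diag)
  have symPi: "symmetric_matrix (Pi_x :: real^('n option)^('n option))"
    unfolding Pi_x_def by (rule symmetric_matrix_diag)
  have symP: "symmetric_matrix (P_mat f L \<delta> \<tau> z)"
    unfolding P_mat_def
    by (intro symmetric_matrix_add symmetric_matrix_scaleR symmetric_matrix_mat symPi
        symmetric_matrix_congruence symD)
  have psd: "0 \<le> v \<bullet> ((P_mat f L \<delta> \<tau> z - \<delta> *\<^sub>R mat 1) *v v)" for v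
  proof -
    have Pi: "0 \<le> v \<bullet> (Pi_x *v v)"
      unfolding Pi_x_def by (rule inner_diag_nonneg) (simp split: option.split)
    have D: "0 \<le> v \<bullet> ((transpose ?J ** ?D ** ?J) *v v)"
      unfolding inner_congruence D_mat_def
      by (rule inner_diag_nonneg) (simp add: omega_def)
    have "v \<bullet> ((P_mat f L \<delta> \<tau> z - \<delta> *\<^sub>R mat 1) *v v) =
        ?c * (v \<bullet> (Pi_x *v v)) + (1/2) * (v \<bullet> ((transpose ?J ** ?D ** ?J) *v v))"
      by (simp add: P_mat_def matrix_vector_mult_add_rdistrib inner_add_right
          flip: scaleR_matrix_vector_assoc)
    then show ?thesis
      using Pi D assms(2) by (simp add: sum_nonneg)
  qed
  show "P_mat f L \<delta> \<tau> z \<succeq> \<delta> *\<^sub>R mat 1"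
    unfolding loewner_ge_def
    using symP psd by (simp add: symmetric_matrix_scaleR symmetric_matrix_mat)
  show "(\<delta> *\<^sub>R mat 1 :: real^('n option)^('n option)) \<succ> 0"
    unfolding loewner_gt_def
    using assms(4)
    by (simp add: symmetric_matrix_scaleR symmetric_matrix_mat symmetric_matrix_zero
        flip: scaleR_matrix_vector_assoc)
qed

end
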